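(* Consider the generalized ARCH model $$X_t=\sigma_t\epsilon_t,\qquad \sigma_t^2=\alpha_0+\alpha_1X_{t-1}^2+l_1L_{t-1},\qquad t\in\mathbb{Z},$$ with $\alpha_0\ge 0$, $\alpha_1,l_1>0$, $\alpha_1<1$ and $\mathbb{E}(L_0^2)<\infty$, and let $(\sigma_t^2)_{t\in\mathbb{Z}}$ be its strictly stationary solution $$\sigma_{t+1}^2=\sum_{i=0}^\infty\left(\prod_{j=0}^{i-1}\alpha_1\epsilon_{t-j}^2\right)(\alpha_0+l_1L_{t-i}).$$ Suppose $\mathbb{E}(\epsilon_0^4)<\infty$. Then $\mathbb{E}(\sigma_0^4)<\infty$ if and only if $\alpha_1<\dfrac{1}{\sqrt{\mathbb{E}(\epsilon_0^4)}}$.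
   Context: Standing assumptions on the model: $(\epsilon_t)_{t\in\mathbb{Z}}$ is an i.i.d. process with $\mathbb{E}(\epsilon_0)=0$ and $\mathbb{E}(\epsilon_0^2)=1$; $(L_t)_{t\in\mathbb{Z}}$ (the liquidity) is a strictly stationary positive process with $\mathbb{E}(L_0)=1$, independent of $(\epsilon_t)_{t\in\mathbb{Z}}$. The empty product is $1$. Here $\sigma_t^4=(\sigma_t^2)^2$. *)

theory Defs
  imports "HOL-Probability.Probability"
begin

definition iid_process :: "'a measure \<Rightarrow> (int \<Rightarrow> 'a \<Rightarrow> real) \<Rightarrow> bool" where
  "iid_process M Y \<longleftrightarrow>
     prob_space.indep_vars M (\<lambda>_. borel) Y UNIV \<and>
     (\<forall>t. distr M borel (Y t) = distr M borel (Y 0))"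

definition strictly_stationary :: "'a measure \<Rightarrow> (int \<Rightarrow> 'a \<Rightarrow> real) \<Rightarrow> bool" where
  "strictly_stationary M Y \<longleftrightarrow>
     (\<forall>t. Y t \<in> borel_measurable M) \<and>
     (\<forall>J h. finite J \<longrightarrow>
        distr M (Pi\<^sub>M J (\<lambda>_. borel)) (\<lambda>\<omega>. \<lambda>t\<in>J. Y (t + h) \<omega>) =
        distr M (Pi\<^sub>M J (\<lambda>_. borel)) (\<lambda>\<omega>. \<lambda>t\<in>J. Y t \<omega>))"

text \<open>Independence of two whole processes, as random elements of the product
  space of all real sequences indexed by the integers.\<close>

definition indep_processes ::
    "'a measure \<Rightarrow> (int \<Rightarrow> 'a \<Rightarrow> real) \<Rightarrow> (int \<Rightarrow> 'a \<Rightarrow> real) \<Rightarrow> bool" where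
  "indep_processes M Y Z \<longleftrightarrow>
     prob_space.indep_var M
       (Pi\<^sub>M UNIV (\<lambda>_. borel)) (\<lambda>\<omega> t. Y t \<omega>)
       (Pi\<^sub>M UNIV (\<lambda>_. borel)) (\<lambda>\<omega> t. Z t \<omega>)"

text \<open>The model equations of a process are understood almost surely; the volatility
  \<open>\<sigma>\<^sub>t\<close> is the nonnegative root of \<open>\<sigma>\<^sub>t\<^sup>2\<close>.\<close>

definition gen_arch ::
    "'a measure \<Rightarrow> (int \<Rightarrow> 'a \<Rightarrow> real) \<Rightarrow> (int \<Rightarrow> 'a \<Rightarrow> real) \<Rightarrow> real \<Rightarrow> real \<Rightarrow> real \<Rightarrow>
      (int \<Rightarrow> 'a \<Rightarrow> real) \<Rightarrow> (int \<Rightarrow> 'a \<Rightarrow> real) \<Rightarrow> bool" where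
  "gen_arch M \<epsilon> L \<alpha>\<^sub>0 \<alpha>\<^sub>1 l\<^sub>1 X \<sigma> \<longleftrightarrow>
     (\<forall>t. X t \<in> borel_measurable M \<and> \<sigma> t \<in> borel_measurable M) \<and>
     (\<forall>t. AE \<omega> in M.
        0 \<le> \<sigma> t \<omega> \<and>
        X t \<omega> = \<sigma> t \<omega> * \<epsilon> t \<omega> \<and>
        (\<sigma> t \<omega>)\<^sup>2 = \<alpha>\<^sub>0 + \<alpha>\<^sub>1 * (X (t - 1) \<omega>)\<^sup>2 + l\<^sub>1 * L (t - 1) \<omega>)"

end

theory Submission
  imports Defs
begin

text \<open>Write \<open>\<sigma>\<^sub>0\<^sup>2 = \<Sum>i. T i\<close> with \<open>T i \<ge> 0\<close>. By independence and stationarity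
  \<open>E (T i)\<^sup>2 = q ^ i * c\<close>, where \<open>q = \<alpha>\<^sub>1\<^sup>2 E \<epsilon>\<^sub>0\<^sup>4\<close> and \<open>c = E (\<alpha>\<^sub>0 + l\<^sub>1 L\<^sub>0)\<^sup>2 > 0\<close>. Since
  \<open>(\<Sum>i. T i)\<^sup>2 \<ge> (\<Sum>i. (T i)\<^sup>2)\<close>, a finite second moment forces \<open>q < 1\<close>. Conversely, for
  \<open>q = s ^ 4 < 1\<close>, the Cauchy-Schwarz inequality with weights \<open>s\<^sup>2 ^ i\<close> gives
  \<open>(\<Sum>i. T i)\<^sup>2 \<le> (\<Sum>i. s\<^sup>2 ^ i) (\<Sum>i. (T i)\<^sup>2 / s\<^sup>2 ^ i)\<close>, whose expectation is
  a product of two geometric series.\<close>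

section \<open>Squares of finite sums\<close>

lemma sum_power2_le_power2_sum:
  fixes f :: "'b \<Rightarrow> real"
  assumes "finite A" "\<And>i. i \<in> A \<Longrightarrow> 0 \<le> f i"
  shows "(\<Sum>i\<in>A. (f i)\<^sup>2) \<le> (\<Sum>i\<in>A. f i)\<^sup>2"
  using assms
proof (induction A rule: finite_induct)
  case (insert x F)
  have "0 \<le> f x * sum f F"
    using insert.prems by (intro mult_nonneg_nonneg sum_nonneg) auto
  then show ?case
    using insert by (simp add: power2_sum)
qed simp

text \<open>Cauchy-Schwarz for the splitting \<open>f i = s ^ i * (f i / s ^ i)\<close>. The
  geometric factor is replaced by its limit, so the constant does not depend on \<open>n\<close> and
  the bound survives the passage to the series.\<close>

lemma weighted_power2_sum_le:
  fixes f :: "nat \<Rightarrow> real"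
  assumes "0 < s" "s < 1"
  shows "(\<Sum>i<n. f i)\<^sup>2 \<le> 1 / (1 - s\<^sup>2) * (\<Sum>i<n. (f i)\<^sup>2 / (s\<^sup>2) ^ i)"
proof -
  have s2: "0 < s\<^sup>2" "s\<^sup>2 < 1"
    using assms by (auto simp: power_less_one_iff)
  have "(\<Sum>i<n. f i)\<^sup>2 = (\<Sum>i<n. s ^ i * (f i / s ^ i))\<^sup>2"
    using assms by simp
  also have "\<dots> \<le> (\<Sum>i<n. (s ^ i)\<^sup>2) * (\<Sum>i<n. (f i / s ^ i)\<^sup>2)"
    by (rule Cauchy_Schwarz_ineq_sum)
  also have "\<dots> = (\<Sum>i<n. (s\<^sup>2) ^ i) * (\<Sum>i<n. (f i)\<^sup>2 / (s\<^sup>2) ^ i)"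
    by (simp add: power_divide power_mult[symmetric] mult.commute)
  also have "\<dots> \<le> 1 / (1 - s\<^sup>2) * (\<Sum>i<n. (f i)\<^sup>2 / (s\<^sup>2) ^ i)"
  proof (rule mult_right_mono)
    have "(\<Sum>i<n. (s\<^sup>2) ^ i) \<le> (\<Sum>i. (s\<^sup>2) ^ i)"
      using s2 by (intro sum_le_suminf summable_geometric) auto
    then show "(\<Sum>i<n. (s\<^sup>2) ^ i) \<le> 1 / (1 - s\<^sup>2)"
      using s2 by (simp add: suminf_geometric)
  qed (intro sum_nonneg, simp)
  finally show ?thesis .
qed

section \<open>Second moment of a random series\<close>

lemma has_bochner_integral_power2_sums_imp_less_1:
  fixes T :: "nat \<Rightarrow> 'a \<Rightarrow> real"
  assumes T: "\<And>i. has_bochner_integral M (\<lambda>x. (T i x)\<^sup>2) (q ^ i * c)"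
    and nonneg: "\<And>i. AE x in M. 0 \<le> T i x"
    and sums: "AE x in M. (\<lambda>i. T i x) sums S x"
    and int: "integrable M (\<lambda>x. (S x)\<^sup>2)"
    and c: "0 < c"
  shows "q < 1"
proof (rule ccontr)
  assume "\<not> q < 1"
  then have q: "1 \<le> q" by simp
  \<comment> \<open>For \<open>q \<ge> 1\<close> each of the first \<open>n\<close> terms has second
    moment at least \<open>c\<close>, and the square of the series dominates the sum of their
    squares. A bound linear in \<open>n\<close> contradicts a finite moment.\<close>
  have "real n * c \<le> (\<integral>x. (S x)\<^sup>2 \<partial>M)" for n
  proof -
    have "real n * c = (\<Sum>i<n. c)" by simp
    also have "\<dots> \<le> (\<Sum>i<n. q ^ i * c)"
      using c q by (intro sum_mono) simp
    also have "\<dots> = (\<Sum>i<n. \<integral>x. (T i x)\<^sup>2 \<partial>M)"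
      by (simp add: has_bochner_integral_integral_eq[OF T])
    also have "\<dots> = (\<integral>x. (\<Sum>i<n. (T i x)\<^sup>2) \<partial>M)"
      using T by (subst Bochner_Integration.integral_sum)
        (auto simp: has_bochner_integral_iff)
    also have "\<dots> \<le> (\<integral>x. (S x)\<^sup>2 \<partial>M)"
    proof (rule integral_mono_AE)
      show "integrable M (\<lambda>x. \<Sum>i<n. (T i x)\<^sup>2)"
        using T by (intro Bochner_Integration.integrable_sum)
          (auto simp: has_bochner_integral_iff)
      \<comment> \<open>Countably many null sets are merged into one that serves all
        \<open>i\<close>.\<close>
      have "AE x in M. \<forall>i. 0 \<le> T i x"
        using nonneg by (simp add: AE_all_countable)
      with sums show "AE x in M. (\<Sum>i<n. (T i x)\<^sup>2) \<le> (S x)\<^sup>2"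
      proof eventually_elim
        case (elim x)
        have "(\<Sum>i<n. (T i x)\<^sup>2) \<le> (\<Sum>i<n. T i x)\<^sup>2"
          using elim by (intro sum_power2_le_power2_sum) auto
        also have "\<dots> \<le> (S x)\<^sup>2"
        proof (rule power_mono)
          show "(\<Sum>i<n. T i x) \<le> S x"
            using elim sum_le_suminf[of "\<lambda>i. T i x" "{..<n}"] by (auto simp: sums_iff)
        qed (use elim in \<open>simp add: sum_nonneg\<close>)
        finally show ?case .
      qed
    qed (rule int)
    finally show ?thesis .
  qed
  moreover obtain n where "(\<integral>x. (S x)\<^sup>2 \<partial>M) < real n * c"
    using reals_Archimedean3[OF c] by blast
  ultimately show False
    by (meson not_le)
qed

lemma integrable_power2_sums:
  fixes T :: "nat \<Rightarrow> 'a \<Rightarrow> real"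
  assumes T: "\<And>i. has_bochner_integral M (\<lambda>x. (T i x)\<^sup>2) (q ^ i * c)"
    and sums: "AE x in M. (\<lambda>i. T i x) sums S x"
    and S: "S \<in> borel_measurable M"
    and c: "0 \<le> c" and q: "0 < q" "q < 1"
  shows "integrable M (\<lambda>x. (S x)\<^sup>2)"
proof -
  \<comment> \<open>The fourth root of \<open>q\<close>: dividing by \<open>(s\<^sup>2) ^ i\<close>
    uses up half of the decay \<open>q = s ^ 4\<close>, so that the weights and the weighted moments
    are both geometric with ratio \<open>s\<^sup>2\<close>.\<close>
  define s where "s = sqrt (sqrt q)"
  have s: "0 < s" "s < 1" "s\<^sup>2 < 1" and q_eq: "q = s\<^sup>2 * s\<^sup>2"
    using q by (auto simp: s_def)
  define U where "U = (\<lambda>i x. (T i x)\<^sup>2 / (s\<^sup>2) ^ i)"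
  define C where "C = 1 / (1 - s\<^sup>2)"
  have C: "0 \<le> C" using s by (simp add: C_def)
  have U_nonneg: "0 \<le> U i x" for i x by (simp add: U_def)
  have U_int: "has_bochner_integral M (U i) ((s\<^sup>2) ^ i * c)" for i
  proof -
    have "has_bochner_integral M (U i) (q ^ i * c / (s\<^sup>2) ^ i)"
      unfolding U_def by (intro has_bochner_integral_divide_zero T)
    also have "q ^ i * c / (s\<^sup>2) ^ i = (s\<^sup>2) ^ i * c"
      using s unfolding q_eq power_mult_distrib by simp
    finally show ?thesis .
  qed
  have U_nn: "(\<integral>\<^sup>+x. ennreal (U i x) \<partial>M) = ennreal ((s\<^sup>2) ^ i * c)" for i
    using U_int[of i] U_nonneg
    by (subst nn_integral_eq_integral) (auto simp: has_bochner_integral_iff)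
  have meas: "U i \<in> borel_measurable M" for i
    using U_int[of i] by (auto simp: has_bochner_integral_iff)
  \<comment> \<open>In \<open>ennreal\<close> the sum and the integral can be exchanged before
    finiteness is known.\<close>
  have "(\<integral>\<^sup>+x. ennreal ((S x)\<^sup>2) \<partial>M) \<le> (\<integral>\<^sup>+x. ennreal C * (\<Sum>i. ennreal (U i x)) \<partial>M)"
  proof (rule nn_integral_mono_AE)
    from sums show "AE x in M. ennreal ((S x)\<^sup>2) \<le> ennreal C * (\<Sum>i. ennreal (U i x))"
    proof eventually_elim
      case (elim x)
      \<comment> \<open>The weighted bound holds for every partial sum with a right-hand side free
        of \<open>n\<close>, hence for the limit.\<close>
      have "(\<lambda>n. ennreal ((\<Sum>i<n. T i x)\<^sup>2)) \<longlonglongrightarrow> ennreal ((S x)\<^sup>2)"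
        using elim by (intro tendsto_ennrealI tendsto_power) (simp add: sums_def)
      moreover have "ennreal ((\<Sum>i<n. T i x)\<^sup>2) \<le> ennreal C * (\<Sum>i. ennreal (U i x))" for n
      proof -
        have "ennreal ((\<Sum>i<n. T i x)\<^sup>2) \<le> ennreal (C * (\<Sum>i<n. U i x))"
          using weighted_power2_sum_le[OF s(1,2)] by (intro ennreal_leI) (simp add: U_def C_def)
        also have "\<dots> = ennreal C * (\<Sum>i<n. ennreal (U i x))"
          using C U_nonneg by (simp add: ennreal_mult sum_nonneg sum_ennreal)
        also have "\<dots> \<le> ennreal C * (\<Sum>i. ennreal (U i x))"
          by (intro mult_left_mono sum_le_suminf) auto
        finally show ?thesis .
      qed
      ultimately show ?case
        by (blast intro: LIMSEQ_le_const2)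
    qed
  qed
  also have "\<dots> = ennreal C * (\<Sum>i. \<integral>\<^sup>+x. ennreal (U i x) \<partial>M)"
    using meas by (simp add: nn_integral_cmult nn_integral_suminf)
  also have "\<dots> = ennreal C * ennreal (\<Sum>i. (s\<^sup>2) ^ i * c)"
    unfolding U_nn using s c by (subst suminf_ennreal2) (auto intro!: summable_mult2)
  also have "\<dots> < \<infinity>"
    by (simp add: ennreal_mult_less_top)
  finally show ?thesis
    using S by (intro integrableI_nonneg) auto
qed

section \<open>Moments under stationarity and independence\<close>

lemma power2_integral_le_integral_power2:
  fixes f :: "'a \<Rightarrow> real"
  assumes "prob_space M" "integrable M f" "integrable M (\<lambda>x. (f x)\<^sup>2)"
  shows "(\<integral>x. f x \<partial>M)\<^sup>2 \<le> (\<integral>x. (f x)\<^sup>2 \<partial>M)"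
  using prob_space.variance_eq[OF assms] prob_space.variance_positive[OF assms(1), of f] by simp

text \<open>The one-point index set \<open>{0}\<close> with shift \<open>t\<close> suffices:
  projecting to the coordinate 0 turns the law on the product space into the marginal law.\<close>

lemma strictly_stationary_distr_eq:
  assumes "strictly_stationary M Y"
  shows "distr M borel (Y t) = distr M borel (Y 0)"
proof -
  have [measurable]: "Y u \<in> borel_measurable M" for u
    using assms by (simp add: strictly_stationary_def)
  let ?P = "Pi\<^sub>M {0::int} (\<lambda>_. borel :: real measure)"
  have eq: "distr M ?P (\<lambda>\<omega>. \<lambda>u\<in>{0}. Y (u + t) \<omega>) = distr M ?P (\<lambda>\<omega>. \<lambda>u\<in>{0}. Y u \<omega>)"
    using assms unfolding strictly_stationary_def by blast
  have "distr (distr M ?P (\<lambda>\<omega>. \<lambda>u\<in>{0}. Y (u + h) \<omega>)) borel (\<lambda>y. y 0) = distr M borel (Y h)" for h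
    by (subst distr_distr) (auto simp: comp_def)
  from this[of t] this[of 0] eq show ?thesis by simp
qed

text \<open>Carries moments known at time 0 over to other times, since an integral sees the variable
  only through its law.\<close>

lemma has_bochner_integral_comp_distr_eq:
  fixes g :: "'b \<Rightarrow> real"
  assumes "distr M N Y = distr M N Z" "Y \<in> measurable M N" "Z \<in> measurable M N"
    and "g \<in> borel_measurable N"
    and "has_bochner_integral M (\<lambda>\<omega>. g (Z \<omega>)) v"
  shows "has_bochner_integral M (\<lambda>\<omega>. g (Y \<omega>)) v"
  using assms integrable_distr_eq[of Y M N g] integrable_distr_eq[of Z M N g]
    integral_distr[of Y M N g] integral_distr[of Z M N g]
  by (simp add: has_bochner_integral_iff)

text \<open>Expectations factor twice: first over the distinct times in \<open>K\<close> within the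
  noise, then between the noise and the liquidity. Identical distributions reduce every factor to
  time 0.\<close>

lemma has_bochner_integral_indep_processes_prod:
  fixes f g :: "real \<Rightarrow> real" and K :: "int set"
  assumes "prob_space M" "iid_process M \<epsilon>" "strictly_stationary M L" "indep_processes M \<epsilon> L"
    and [measurable]: "f \<in> borel_measurable borel" "g \<in> borel_measurable borel"
    and f: "has_bochner_integral M (\<lambda>\<omega>. f (\<epsilon> 0 \<omega>)) a"
    and g: "has_bochner_integral M (\<lambda>\<omega>. g (L 0 \<omega>)) b"
    and K: "finite K"
  shows "has_bochner_integral M (\<lambda>\<omega>. (\<Prod>t\<in>K. f (\<epsilon> t \<omega>)) * g (L u \<omega>)) (a ^ card K * b)"
proof -
  interpret prob_space M by fact
  have iv: "indep_vars (\<lambda>_. borel) \<epsilon> UNIV"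
    and \<epsilon>_distr: "distr M borel (\<epsilon> t) = distr M borel (\<epsilon> 0)" for t
    using assms(2) by (auto simp: iid_process_def)
  have [measurable]: "\<epsilon> t \<in> borel_measurable M" for t
    using iv by (auto simp: indep_vars_def)
  have [measurable]: "L t \<in> borel_measurable M" for t
    using assms(3) by (simp add: strictly_stationary_def)
  have f_int: "has_bochner_integral M (\<lambda>\<omega>. f (\<epsilon> t \<omega>)) a" for t
    by (rule has_bochner_integral_comp_distr_eq[OF \<epsilon>_distr _ _ _ f]) auto
  have g_int: "has_bochner_integral M (\<lambda>\<omega>. g (L u \<omega>)) b"
    by (rule has_bochner_integral_comp_distr_eq[OF strictly_stationary_distr_eq[OF assms(3)] _ _ _ g]) auto
  from indep_vars_compose2[OF indep_vars_subset[OF iv, of K], of "\<lambda>_. f" "\<lambda>_. borel"]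
  have fv: "indep_vars (\<lambda>_. borel) (\<lambda>t \<omega>. f (\<epsilon> t \<omega>)) K" by simp
  have prod_int: "integrable M (\<lambda>\<omega>. \<Prod>t\<in>K. f (\<epsilon> t \<omega>))"
    using f_int by (intro indep_vars_integrable fv K) (auto simp: has_bochner_integral_iff)
  have prod_eq: "(\<integral>\<omega>. (\<Prod>t\<in>K. f (\<epsilon> t \<omega>)) \<partial>M) = a ^ card K"
    using f_int by (subst indep_vars_lebesgue_integral[OF K fv]) (auto simp: has_bochner_integral_iff)
  have "indep_var (Pi\<^sub>M UNIV (\<lambda>_. borel)) (\<lambda>\<omega> t. \<epsilon> t \<omega>) (Pi\<^sub>M UNIV (\<lambda>_. borel)) (\<lambda>\<omega> t. L t \<omega>)"
    using assms(4) by (simp add: indep_processes_def)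
  \<comment> \<open>Both variables are measurable functions of finitely many coordinates of the two
    paths, so they inherit the independence of the whole processes.\<close>
  then have "indep_var borel ((\<lambda>y. \<Prod>t\<in>K. f (y t)) \<circ> (\<lambda>\<omega> t. \<epsilon> t \<omega>))
      borel ((\<lambda>y. g (y u)) \<circ> (\<lambda>\<omega> t. L t \<omega>))"
    by (rule indep_var_compose) measurable
  then have ind: "indep_var borel (\<lambda>\<omega>. \<Prod>t\<in>K. f (\<epsilon> t \<omega>)) borel (\<lambda>\<omega>. g (L u \<omega>))"
    by (simp add: comp_def)
  show ?thesis
    using indep_var_integrable[OF ind prod_int] indep_var_lebesgue_integral[OF ind prod_int]
      prod_eq g_int by (simp add: has_bochner_integral_iff)
qed

section \<open>The moment criterion for the volatility\<close>

theorem lemma2p5: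
  fixes M :: "'a measure"
    and \<epsilon> L X \<sigma> :: "int \<Rightarrow> 'a \<Rightarrow> real"
    and \<alpha>\<^sub>0 \<alpha>\<^sub>1 l\<^sub>1 :: real
  assumes "prob_space M"
    and "iid_process M \<epsilon>"
    and "integrable M (\<epsilon> 0)" and "(\<integral>\<omega>. \<epsilon> 0 \<omega> \<partial>M) = 0"
    and "integrable M (\<lambda>\<omega>. (\<epsilon> 0 \<omega>)\<^sup>2)" and "(\<integral>\<omega>. (\<epsilon> 0 \<omega>)\<^sup>2 \<partial>M) = 1"
    and "strictly_stationary M L"
    and "\<forall>t. AE \<omega> in M. 0 < L t \<omega>"
    and "integrable M (L 0)" and "(\<integral>\<omega>. L 0 \<omega> \<partial>M) = 1"
    and "indep_processes M \<epsilon> L"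
    and "0 \<le> \<alpha>\<^sub>0" and "0 < \<alpha>\<^sub>1" and "0 < l\<^sub>1" and "\<alpha>\<^sub>1 < 1"
    and "integrable M (\<lambda>\<omega>. (L 0 \<omega>)\<^sup>2)"
    and "gen_arch M \<epsilon> L \<alpha>\<^sub>0 \<alpha>\<^sub>1 l\<^sub>1 X \<sigma>"
    and "strictly_stationary M (\<lambda>t \<omega>. (\<sigma> t \<omega>)\<^sup>2)"
    and "\<forall>t. AE \<omega> in M.
           (\<lambda>i. (\<Prod>j<i. \<alpha>\<^sub>1 * (\<epsilon> (t - int j) \<omega>)\<^sup>2) * (\<alpha>\<^sub>0 + l\<^sub>1 * L (t - int i) \<omega>))
             sums (\<sigma> (t + 1) \<omega>)\<^sup>2"
    and "integrable M (\<lambda>\<omega>. (\<epsilon> 0 \<omega>) ^ 4)"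
  shows "integrable M (\<lambda>\<omega>. ((\<sigma> 0 \<omega>)\<^sup>2)\<^sup>2) \<longleftrightarrow>
         \<alpha>\<^sub>1 < 1 / sqrt (\<integral>\<omega>. (\<epsilon> 0 \<omega>) ^ 4 \<partial>M)"
proof -
  interpret prob_space M by fact
  define \<kappa> where "\<kappa> = (\<integral>\<omega>. (\<epsilon> 0 \<omega>) ^ 4 \<partial>M)"
  define q where "q = \<alpha>\<^sub>1\<^sup>2 * \<kappa>"
  define c where "c = (\<integral>\<omega>. (\<alpha>\<^sub>0 + l\<^sub>1 * L 0 \<omega>)\<^sup>2 \<partial>M)"
  \<comment> \<open>The terms of the series at \<open>t = - 1\<close>, whose sum is the squared
    volatility at time 0.\<close>
  define T where "T = (\<lambda>i \<omega>. (\<Prod>j<i. \<alpha>\<^sub>1 * (\<epsilon> (- 1 - int j) \<omega>)\<^sup>2) * (\<alpha>\<^sub>0 + l\<^sub>1 * L (- 1 - int i) \<omega>))"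
  \<comment> \<open>The fourth moment dominates the square of the second, which is 1; in particular
    the division by \<open>sqrt \<kappa>\<close> is genuine.\<close>
  have \<kappa>: "1 \<le> \<kappa>"
    using power2_integral_le_integral_power2[OF assms(1), of "\<lambda>\<omega>. (\<epsilon> 0 \<omega>)\<^sup>2"] assms(5,6,20)
    by (simp add: \<kappa>_def)
  have q: "0 < q"
    using \<kappa> assms(13) by (simp add: q_def)
  have L2: "integrable M (\<lambda>\<omega>. (\<alpha>\<^sub>0 + l\<^sub>1 * L 0 \<omega>)\<^sup>2)"
    using assms(9,16) by (simp add: power2_sum power_mult_distrib)
  \<comment> \<open>The second moment \<open>c\<close> is at least the square of the mean, and the
    mean is \<open>\<alpha>\<^sub>0 + l\<^sub>1\<close> because the liquidity has mean 1.\<close>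
  have "0 < (\<alpha>\<^sub>0 + l\<^sub>1)\<^sup>2"
    using assms(12,14) by simp
  also have "\<alpha>\<^sub>0 + l\<^sub>1 = (\<integral>\<omega>. \<alpha>\<^sub>0 + l\<^sub>1 * L 0 \<omega> \<partial>M)"
    using assms(9,10) by (simp add: prob_space)
  also have "\<dots>\<^sup>2 \<le> c"
    unfolding c_def using assms(1,9) L2 by (intro power2_integral_le_integral_power2) auto
  finally have c: "0 < c" .
  have T_int: "has_bochner_integral M (\<lambda>\<omega>. (T i \<omega>)\<^sup>2) (q ^ i * c)" for i
  proof -
    \<comment> \<open>The noise times \<open>- 1, ..., - i\<close> in \<open>T i\<close> as a set;
      injectivity of the indexing gives it \<open>i\<close> elements, hence the exponent in
      \<open>q ^ i\<close>.\<close>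
    let ?K = "(\<lambda>j. - 1 - int j) ` {..<i}"
    have inj: "inj_on (\<lambda>j. - 1 - int j) {..<i}"
      by (simp add: inj_on_def)
    have "has_bochner_integral M (\<lambda>\<omega>. \<alpha>\<^sub>1\<^sup>2 * (\<epsilon> 0 \<omega>) ^ 4) q"
      unfolding q_def \<kappa>_def using assms(20)
      by (intro has_bochner_integral_mult_right has_bochner_integral_integrable)
    then have "has_bochner_integral M
        (\<lambda>\<omega>. (\<Prod>t\<in>?K. \<alpha>\<^sub>1\<^sup>2 * (\<epsilon> t \<omega>) ^ 4) * (\<alpha>\<^sub>0 + l\<^sub>1 * L (- 1 - int i) \<omega>)\<^sup>2) (q ^ card ?K * c)"
      using has_bochner_integral_integrable[OF L2] unfolding c_def[symmetric]
      by (intro has_bochner_integral_indep_processes_prod[OF assms(1,2,7,11),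
            where f = "\<lambda>x. \<alpha>\<^sub>1\<^sup>2 * x ^ 4" and g = "\<lambda>x. (\<alpha>\<^sub>0 + l\<^sub>1 * x)\<^sup>2"])
        auto
    then show ?thesis
      by (simp add: T_def power_mult_distrib prod_power_distrib prod.reindex[OF inj] card_image[OF inj])
  qed
  have T_nonneg: "AE \<omega> in M. 0 \<le> T i \<omega>" for i
  proof -
    have "AE \<omega> in M. 0 < L (- 1 - int i) \<omega>"
      using assms(8) by blast
    then show ?thesis
      by eventually_elim (use assms(12-14) in \<open>auto simp: T_def intro!: mult_nonneg_nonneg prod_nonneg add_nonneg_nonneg\<close>)
  qed
  have sums: "AE \<omega> in M. (\<lambda>i. T i \<omega>) sums (\<sigma> 0 \<omega>)\<^sup>2"
    using assms(19)[rule_format, of "- 1"] by (simp add: T_def)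
  have S: "(\<lambda>\<omega>. (\<sigma> 0 \<omega>)\<^sup>2) \<in> borel_measurable M"
    using assms(18) by (simp add: strictly_stationary_def)
  \<comment> \<open>The two series lemmas with the squared volatility as \<open>S\<close> give one
    implication each.\<close>
  have "integrable M (\<lambda>\<omega>. ((\<sigma> 0 \<omega>)\<^sup>2)\<^sup>2) \<longleftrightarrow> q < 1"
    using has_bochner_integral_power2_sums_imp_less_1[OF T_int T_nonneg sums _ c]
      integrable_power2_sums[OF T_int sums S _ q] c by auto
  \<comment> \<open>Here \<open>q\<close> is the square of the nonnegative number
    \<open>\<alpha>\<^sub>1 * sqrt \<kappa>\<close>, so either is below 1 exactly when the other
    is.\<close>
  also have "\<dots> \<longleftrightarrow> (\<alpha>\<^sub>1 * sqrt \<kappa>)\<^sup>2 < 1"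
    using \<kappa> by (simp add: q_def power_mult_distrib)
  also have "\<dots> \<longleftrightarrow> \<alpha>\<^sub>1 * sqrt \<kappa> < 1"
    using \<kappa> assms(13) by (simp add: power_less_one_iff)
  also have "\<dots> \<longleftrightarrow> \<alpha>\<^sub>1 < 1 / sqrt \<kappa>"
    using \<kappa> by (simp add: pos_less_divide_eq)
  finally show ?thesis
    by (simp add: \<kappa>_def)
qed

end
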